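(* Let $a,c\in\mathbb{R}$ with $c>0$ and $-ac>0$, and put $\nu^2=-a/c$, $\nu>0$. Let $\phi\in C^2$ and $\psi\in C^1$ be functions of one real variable, and consider the Cauchy problem $$u_{tt}-\nu^2u_{xx}=0,\qquad u(x,0)=\phi(x),\qquad u_t(x,0)=\psi(x).$$ Let $\Gamma: x=x(t)$ be a smooth curve contained in a domain $D$ of the $(x,t)$-plane, and suppose that $\Gamma$ is a weakly discontinuous curve, in the sense defined in the context, of a solution $u$ of this problem on $D$. Then $x=x(t)$ must satisfy $$\frac{dx}{dt}=\lambda_1\quad\text{or}\quad\frac{dx}{dt}=\lambda_2,$$ where $\lambda_1,\lambda_2$ are the real roots of the equation $c\lambda^2+a=0$, i.e. $\lambda_1=\nu$ and $\lambda_2=-\nu$.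
   Context: Definition (weakly discontinuous curve). Let $D$ be a domain of the $(x,t)$-plane and let $\Gamma\subset D$ be a smooth curve, given as a graph $x=x(t)$, that divides $D$ into two parts $D_1$ and $D_2$ (one on each side of $\Gamma$). $\Gamma$ is a weakly discontinuous curve of the equation $u_{tt}-\nu^2u_{xx}=0$ (with solution $u$) if: (1) $u\in C^1(D)\cap C^2(D\setminus\Gamma)$; (2) $u$ satisfies the equation at all points of $D\setminus\Gamma$ (where second derivatives exist), and satisfies the initial conditions at the points of the line $t=0$ belonging to the region where $u$ is defined; (3) the second partial derivatives of $u$ have a discontinuity of the first kind on $\Gamma$. Discontinuity of the first kind here means a jump discontinuity: at every point of $\Gamma$ the one-sided limits of the second partial derivatives $u_{xx},u_{xt},u_{tt}$ from $D_1$ and from $D_2$ exist and are finite, but the second partial derivatives are discontinuous across $\Gamma$ there, i.e. the limits from the two sides do not agree. *)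

theory Defs
  imports "HOL-Analysis.Analysis"
begin

text \<open>
  A point of the plane is a pair \<open>(x, t)\<close>: space first, time second.
  A function on a subset of the plane is a total function of which only the values on that subset
  matter; all regions used below are open, so the derivatives do not depend on other values.
\<close>

definition partial_x :: "(real \<times> real \<Rightarrow> real) \<Rightarrow> real \<times> real \<Rightarrow> real" where
  "partial_x u = (\<lambda>(x, t). deriv (\<lambda>y. u (y, t)) x)"

definition partial_t :: "(real \<times> real \<Rightarrow> real) \<Rightarrow> real \<times> real \<Rightarrow> real" where
  "partial_t u = (\<lambda>(x, t). deriv (\<lambda>s. u (x, s)) t)"

definition C1_plane :: "(real \<times> real) set \<Rightarrow> (real \<times> real \<Rightarrow> real) \<Rightarrow> bool" where
  "C1_plane S u \<longleftrightarrow>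
     (\<forall>(x, t)\<in>S. (\<lambda>y. u (y, t)) differentiable (at x) \<and> (\<lambda>s. u (x, s)) differentiable (at t)) \<and>
     continuous_on S (partial_x u) \<and> continuous_on S (partial_t u)"

definition C2_plane :: "(real \<times> real) set \<Rightarrow> (real \<times> real \<Rightarrow> real) \<Rightarrow> bool" where
  "C2_plane S u \<longleftrightarrow> C1_plane S u \<and> C1_plane S (partial_x u) \<and> C1_plane S (partial_t u)"

definition domain_in_plane :: "(real \<times> real) set \<Rightarrow> bool" where
  "domain_in_plane D \<longleftrightarrow> open D \<and> connected D \<and> D \<noteq> {}"

definition graph_curve :: "real set \<Rightarrow> (real \<Rightarrow> real) \<Rightarrow> (real \<times> real) set" where
  "graph_curve I \<xi> = (\<lambda>t. (\<xi> t, t)) ` I"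

text \<open>
  The complement of the curve in \<open>D\<close> is the disjoint union of two open parts; near every point
  of the curve, \<open>D1\<close> is the side \<open>x < \<xi> t\<close> and \<open>D2\<close> the side \<open>x > \<xi> t\<close>. The
  sides are only prescribed locally, since \<open>D\<close> need not be contained in the strip over \<open>I\<close>.
\<close>

definition divides_into ::
  "(real \<times> real) set \<Rightarrow> real set \<Rightarrow> (real \<Rightarrow> real) \<Rightarrow>
   (real \<times> real) set \<Rightarrow> (real \<times> real) set \<Rightarrow> bool" where
  "divides_into D I \<xi> D1 D2 \<longleftrightarrow>
     open D1 \<and> open D2 \<and> D1 \<noteq> {} \<and> D2 \<noteq> {} \<and> D1 \<inter> D2 = {} \<and>
     D - graph_curve I \<xi> = D1 \<union> D2 \<and>
     (\<forall>s\<in>I. \<forall>\<^sub>F (x, t) in nhds (\<xi> s, s).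
        (x < \<xi> t \<longrightarrow> (x, t) \<in> D1) \<and> (x > \<xi> t \<longrightarrow> (x, t) \<in> D2))"

text \<open>
  Since \<open>u\<close> is twice continuously differentiable off the curve, the mixed derivative may be
  taken in either order there.
\<close>

definition second_partials :: "(real \<times> real \<Rightarrow> real) \<Rightarrow> real \<times> real \<Rightarrow> real \<times> real \<times> real" where
  "second_partials u = (\<lambda>p.
     (partial_x (partial_x u) p, partial_t (partial_x u) p, partial_t (partial_t u) p))"

definition first_kind_discontinuity ::
  "(real \<times> real \<Rightarrow> 'a::topological_space) \<Rightarrow> (real \<times> real) set \<Rightarrow> (real \<times> real) set \<Rightarrow>
   real \<times> real \<Rightarrow> bool" where
  "first_kind_discontinuity f D1 D2 p \<longleftrightarrow>
     (\<exists>l r. (f \<longlongrightarrow> l) (at p within D1) \<and> (f \<longlongrightarrow> r) (at p within D2) \<and> l \<noteq> r)"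

definition wave_solution_off_curve ::
  "real \<Rightarrow> (real \<Rightarrow> real) \<Rightarrow> (real \<Rightarrow> real) \<Rightarrow> (real \<times> real) set \<Rightarrow> (real \<times> real) set \<Rightarrow>
   (real \<times> real \<Rightarrow> real) \<Rightarrow> bool" where
  "wave_solution_off_curve \<nu> \<phi> \<psi> D \<Gamma> u \<longleftrightarrow>
     (\<forall>p \<in> D - \<Gamma>. partial_t (partial_t u) p - \<nu>\<^sup>2 * partial_x (partial_x u) p = 0) \<and>
     (\<forall>x. (x, 0) \<in> D \<longrightarrow> u (x, 0) = \<phi> x \<and> partial_t u (x, 0) = \<psi> x)"

text \<open>
  The discontinuity is that of the triple of second derivatives: the two one-sided limits
  of at least one of them differ.
\<close>

definition weakly_discontinuous_curve ::
  "real \<Rightarrow> (real \<Rightarrow> real) \<Rightarrow> (real \<Rightarrow> real) \<Rightarrow> (real \<times> real) set \<Rightarrow> real set \<Rightarrow> (real \<Rightarrow> real) \<Rightarrow>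
   (real \<times> real \<Rightarrow> real) \<Rightarrow> bool" where
  "weakly_discontinuous_curve \<nu> \<phi> \<psi> D I \<xi> u \<longleftrightarrow>
     (\<exists>D1 D2. divides_into D I \<xi> D1 D2 \<and>
        C1_plane D u \<and> C2_plane (D - graph_curve I \<xi>) u \<and>
        wave_solution_off_curve \<nu> \<phi> \<psi> D (graph_curve I \<xi>) u \<and>
        (\<forall>p \<in> graph_curve I \<xi>. first_kind_discontinuity (second_partials u) D1 D2 p))"

end

theory Submission
  imports Defs
begin

text \<open>
  The first derivatives of \<open>u\<close> are continuous across the curve, so their restrictions to the curve
  are single functions of \<open>t\<close>. Each restriction can be differentiated along the curve using the
  second derivatives on the left side only, or those on the right side only, and both computations
  must give the same number. Writing \<open>[g]\<close> for the difference of the two one-sided limits of \<open>g\<close>,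
  this gives the classical kinematic compatibility conditions

  \<open>[u\<^sub>x\<^sub>x] \<xi>' + [u\<^sub>x\<^sub>t] = 0\<close> and \<open>[u\<^sub>x\<^sub>t] \<xi>' + [u\<^sub>t\<^sub>t] = 0\<close>.

  The equation, which survives in the limit from each side, adds \<open>[u\<^sub>t\<^sub>t] = \<nu>\<^sup>2 [u\<^sub>x\<^sub>x]\<close>. Eliminating
  the other two jumps leaves \<open>(\<xi>'\<^sup>2 - \<nu>\<^sup>2) [u\<^sub>x\<^sub>x] = 0\<close>. If \<open>[u\<^sub>x\<^sub>x]\<close> were zero, all three jumps
  would be, which a discontinuity excludes; hence \<open>\<xi>'\<^sup>2 = \<nu>\<^sup>2\<close> at each point. As \<open>\<xi>'\<close> is
  continuous on an interval, it cannot switch between \<open>\<nu>\<close> and \<open>- \<nu>\<close>.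

  The analytic work is in \<open>DERIV_along_graph_one_sided\<close>: the second derivatives have limits at the
  curve but need not exist on it, so the chain rule is applied on parallel copies of the curve
  inside one side, which are then moved onto the curve. The second compatibility condition
  involves \<open>(u\<^sub>t)\<^sub>x\<close> where the first has \<open>(u\<^sub>x)\<^sub>t\<close>; that these agree off the curve is
  \<open>C2_plane_mixed_partials_eq\<close>.
\<close>

section \<open>Continuously differentiable functions in the plane\<close>

lemma C1_plane_subset: "C1_plane S u \<Longrightarrow> T \<subseteq> S \<Longrightarrow> C1_plane T u"
  unfolding C1_plane_def by (blast intro: continuous_on_subset)

lemma C1_plane_DERIV_x:
  assumes "C1_plane S u" "(x, t) \<in> S"
  shows "((\<lambda>y. u (y, t)) has_real_derivative partial_x u (x, t)) (at x)"
  using assms by (auto simp: C1_plane_def partial_x_def DERIV_deriv_iff_real_differentiable)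

lemma C1_plane_DERIV_t:
  assumes "C1_plane S u" "(x, t) \<in> S"
  shows "((\<lambda>s. u (x, s)) has_real_derivative partial_t u (x, t)) (at t)"
  using assms by (auto simp: C1_plane_def partial_t_def DERIV_deriv_iff_real_differentiable)

text \<open>
  Total differentiability is what makes the chain rule available for a curve that is not parallel
  to an axis.
\<close>

lemma C1_plane_has_derivative:
  assumes "open S" "C1_plane S u" "(x, t) \<in> S"
  shows "(u has_derivative (\<lambda>(h, k). partial_x u (x, t) * h + partial_t u (x, t) * k)) (at (x, t))"
proof -
  \<comment> \<open>The criterion for total differentiability works on a product with a convex second factor.\<close>
  obtain A B where AB: "open A" "open B" "(x, t) \<in> A \<times> B" "A \<times> B \<subseteq> S"
    using open_prod_elim[OF assms(1,3)] by blast
  obtain d where d: "d > 0" "ball t d \<subseteq> B"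
    using AB by (auto elim: openE)
  have sub: "A \<times> ball t d \<subseteq> S"
    using AB d by auto
  have op: "open (A \<times> ball t d)"
    using AB by (intro open_Times) auto
  have mem: "(x, t) \<in> A \<times> ball t d"
    using AB d by auto
  have "((\<lambda>(y, s). u (y, s)) has_derivative
      (\<lambda>(h, k). (\<lambda>h. partial_x u (x, t) * h) h + blinfun_mult_right (partial_t u (x, t)) k))
      (at (x, t) within A \<times> ball t d)"
  proof (rule has_derivative_partialsI[where fy = "\<lambda>y s. blinfun_mult_right (partial_t u (y, s))"])
    show "((\<lambda>y. u (y, t)) has_derivative (\<lambda>h. partial_x u (x, t) * h)) (at x within A)"
      using C1_plane_DERIV_x[OF assms(2,3)]
      by (simp add: has_field_derivative_def has_derivative_at_withinI)
    show "((\<lambda>s. u (y, s)) has_derivative blinfun_mult_right (partial_t u (y, s))) (at s within ball t d)"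
      if "y \<in> A" "s \<in> ball t d" for y s
    proof -
      have "(y, s) \<in> S"
        using that sub by auto
      then show ?thesis
        using C1_plane_DERIV_t[OF assms(2), of y s]
        by (simp add: has_field_derivative_def has_derivative_at_withinI)
    qed
    have "continuous (at (x, t) within A \<times> ball t d) (partial_t u)"
      using assms(2) sub mem unfolding C1_plane_def continuous_on_eq_continuous_within
      by (meson continuous_within_subset subsetD)
    then show "continuous (at (x, t) within A \<times> ball t d)
        (\<lambda>(y, s). blinfun_mult_right (partial_t u (y, s)))"
      unfolding split_beta' prod.collapse
      by (rule bounded_linear.continuous[OF bounded_linear_blinfun_mult_right])
  qed (use d in auto)
  then show ?thesis
    using at_within_open[OF mem op] by simp
qed

section \<open>Equality of mixed partial derivatives\<close>

text \<open>
  The mean value theorem in \<open>x\<close>, applied to the increment of \<open>v\<close> over a step in \<open>t\<close>, and then the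
  mean value theorem in \<open>t\<close>. The second difference on the left is symmetric in the two
  variables, so exchanging them gives the same quantity as a value of the other mixed derivative.
\<close>

lemma second_difference_mean_value:
  fixes v :: "real \<times> real \<Rightarrow> real"
  assumes "C1_plane S v" "C1_plane S (partial_x v)" "h > 0"
    and box: "{x..x + h} \<times> {t..t + h} \<subseteq> S"
  obtains y s where "x < y" "y < x + h" "t < s" "s < t + h"
    "v (x + h, t + h) - v (x + h, t) - v (x, t + h) + v (x, t)
      = h * h * partial_t (partial_x v) (y, s)"
proof -
  have "\<exists>y>x. y < x + h \<and> (v (x + h, t + h) - v (x + h, t)) - (v (x, t + h) - v (x, t))
      = ((x + h) - x) * (partial_x v (y, t + h) - partial_x v (y, t))"
    using assms
    by (intro MVT2[where f = "\<lambda>y. v (y, t + h) - v (y, t)"])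
      (auto intro!: DERIV_diff C1_plane_DERIV_x)
  then obtain y where y: "x < y" "y < x + h"
    "(v (x + h, t + h) - v (x + h, t)) - (v (x, t + h) - v (x, t))
      = h * (partial_x v (y, t + h) - partial_x v (y, t))"
    by auto
  have "\<exists>s>t. s < t + h \<and> partial_x v (y, t + h) - partial_x v (y, t)
      = ((t + h) - t) * partial_t (partial_x v) (y, s)"
    using assms y
    by (intro MVT2[where f = "\<lambda>s. partial_x v (y, s)"]) (auto intro!: C1_plane_DERIV_t)
  then obtain s where "t < s" "s < t + h"
    "partial_x v (y, t + h) - partial_x v (y, t) = h * partial_t (partial_x v) (y, s)"
    by auto
  with y that[of y s] show ?thesis
    by (simp add: algebra_simps)
qed

lemma partial_x_swap: "partial_x (v \<circ> prod.swap) = partial_t v \<circ> prod.swap"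
  and partial_t_swap: "partial_t (v \<circ> prod.swap) = partial_x v \<circ> prod.swap"
  by (auto simp: partial_x_def partial_t_def fun_eq_iff)

lemma C1_plane_swap:
  assumes "C1_plane S v"
  shows "C1_plane (prod.swap ` S) (v \<circ> prod.swap)"
proof -
  have "continuous_on (prod.swap ` S) (w \<circ> prod.swap)" if "continuous_on S w"
    for w :: "real \<times> real \<Rightarrow> real"
    using that by (intro continuous_on_compose continuous_on_swap) (simp add: image_image)
  with assms show ?thesis
    unfolding C1_plane_def partial_x_swap partial_t_swap by fastforce
qed

text \<open>
  If the two mixed derivatives differed at a point, then by continuity their values on a
  small square at that point would be separated; but the second difference over the square is a
  common multiple of a value of each.
\<close>

lemma C2_plane_mixed_partials_eq:
  assumes "open S" "C2_plane S u" "(x, t) \<in> S"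
  shows "partial_t (partial_x u) (x, t) = partial_x (partial_t u) (x, t)"
proof (rule ccontr)
  define P where "P = partial_t (partial_x u)"
  define Q where "Q = partial_x (partial_t u)"
  assume neq: "\<not> ?thesis"
  define e where "e = \<bar>P (x, t) - Q (x, t)\<bar> / 2"
  have e: "e > 0"
    using neq by (simp add: e_def P_def Q_def)
  have C: "C1_plane S u" "C1_plane S (partial_x u)" "C1_plane S (partial_t u)"
    using assms(2) by (auto simp: C2_plane_def)
  then have "continuous_on S P" "continuous_on S Q"
    by (auto simp: C1_plane_def P_def Q_def)
  then have "(P \<longlongrightarrow> P (x, t)) (nhds (x, t))" "(Q \<longlongrightarrow> Q (x, t)) (nhds (x, t))"
    using assms(1,3) continuous_on_eq_continuous_at
    by (auto simp: isCont_def tendsto_nhds_iff)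
  then have "\<forall>\<^sub>F p in nhds (x, t). p \<in> S \<and> dist (P p) (P (x, t)) < e \<and> dist (Q p) (Q (x, t)) < e"
    using assms(1,3) e by (intro eventually_conj tendstoD eventually_nhds_in_open)
  then obtain X T where XT: "\<forall>\<^sub>F y in nhds x. X y" "\<forall>\<^sub>F s in nhds t. T s"
    and near: "\<And>y s. X y \<Longrightarrow> T s \<Longrightarrow>
      (y, s) \<in> S \<and> dist (P (y, s)) (P (x, t)) < e \<and> dist (Q (y, s)) (Q (x, t)) < e"
    unfolding nhds_prod eventually_prod_filter by blast
  from XT obtain d1 d2 where d: "d1 > 0" "\<And>y. dist y x < d1 \<Longrightarrow> X y" 
    "d2 > 0" "\<And>s. dist s t < d2 \<Longrightarrow> T s"
    unfolding eventually_nhds_metric by blast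
  define h where "h = min d1 d2 / 2"
  have h: "h > 0" "h < d1" "h < d2"
    using d by (auto simp: h_def)
  have X: "X y" if "x \<le> y" "y \<le> x + h" for y
    using that h by (intro d) (auto simp: dist_real_def)
  have T: "T s" if "t \<le> s" "s \<le> t + h" for s
    using that h by (intro d) (auto simp: dist_real_def)
  have box: "{x..x + h} \<times> {t..t + h} \<subseteq> S"
    using near X T by auto
  \<comment> \<open>Reflection in the diagonal exchanges the roles of \<open>x\<close> and \<open>t\<close>.\<close>
  have "{t..t + h} \<times> {x..x + h} \<subseteq> prod.swap ` S"
    using box by force
  then obtain s' y' where ys': "t < s'" "s' < t + h" "x < y'" "y' < x + h"
    "u (x + h, t + h) - u (x, t + h) - u (x + h, t) + u (x, t) = h * h * Q (y', s')"
    using second_difference_mean_value[of "prod.swap ` S" "u \<circ> prod.swap" h t x]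
      C1_plane_swap[OF C(1)] C1_plane_swap[OF C(3)] h
    by (auto simp: partial_x_swap partial_t_swap Q_def)
  obtain y s where ys: "x < y" "y < x + h" "t < s" "s < t + h"
    "u (x + h, t + h) - u (x + h, t) - u (x, t + h) + u (x, t) = h * h * P (y, s)"
    using second_difference_mean_value[OF C(1,2) h(1) box] unfolding P_def by blast
  have "h * h * P (y, s) = h * h * Q (y', s')"
    using ys(5) ys'(5) by linarith
  then have "P (y, s) = Q (y', s')"
    using h by simp
  moreover have "dist (P (y, s)) (P (x, t)) < e" "dist (Q (y', s')) (Q (x, t)) < e"
    using near X T ys ys' by auto
  moreover have "\<bar>P (x, t) - Q (x, t)\<bar> = 2 * e"
    by (simp add: e_def)
  ultimately show False
    unfolding dist_real_def by arith
qed

section \<open>Derivatives along a curve from one side\<close>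

text \<open>
  Shifting the curve horizontally by \<open>\<sigma> * \<epsilon>\<close>, \<open>\<epsilon> > 0\<close>, puts it on the side selected by the sign of
  \<open>\<sigma>\<close>. Letting \<open>\<epsilon>\<close> and \<open>t\<close> vary independently gives the uniformity in \<open>t\<close> that moving the
  shifted curve back onto the original one requires.
\<close>

lemma filterlim_beside_graph:
  fixes \<sigma> :: real
  assumes "isCont \<xi> s" "\<sigma> \<noteq> 0"
    and side: "\<forall>\<^sub>F (x, t) in nhds (\<xi> s, s). \<sigma> * (x - \<xi> t) > 0 \<longrightarrow> (x, t) \<in> G"
  shows "filterlim (\<lambda>p. (\<xi> (snd p) + \<sigma> * fst p, snd p)) (at (\<xi> s, s) within G) (at_right 0 \<times>\<^sub>F nhds s)"
proof -
  have \<xi>: "(\<xi> \<longlongrightarrow> \<xi> s) (nhds s)"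
    using assms(1) by (simp add: isCont_def tendsto_nhds_iff)
  have offset: "((\<lambda>p. fst p) \<longlongrightarrow> 0) (at_right (0::real) \<times>\<^sub>F nhds s)"
    by (rule filterlim_mono[OF filterlim_fst at_within_le_nhds order_refl])
  have lim: "((\<lambda>p. (\<xi> (snd p) + \<sigma> * fst p, snd p)) \<longlongrightarrow> (\<xi> s + \<sigma> * 0, s)) (at_right 0 \<times>\<^sub>F nhds s)"
    by (intro tendsto_intros filterlim_compose[OF \<xi>] filterlim_snd offset)
  have pos: "\<forall>\<^sub>F p in at_right 0 \<times>\<^sub>F nhds s. fst p > (0::real)"
    by (rule eventually_compose_filterlim[OF _ filterlim_fst]) (rule eventually_at_right_less)
  have "\<forall>\<^sub>F p in at_right 0 \<times>\<^sub>F nhds s. \<sigma> * (\<xi> (snd p) + \<sigma> * fst p - \<xi> (snd p)) > 0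
      \<longrightarrow> (\<xi> (snd p) + \<sigma> * fst p, snd p) \<in> G"
    using eventually_compose_filterlim[OF side lim[simplified]] by simp
  with pos have "\<forall>\<^sub>F p in at_right 0 \<times>\<^sub>F nhds s. (\<xi> (snd p) + \<sigma> * fst p, snd p) \<in> G
      \<and> (\<xi> (snd p) + \<sigma> * fst p, snd p) \<noteq> (\<xi> s, s)"
  proof eventually_elim
    case (elim p)
    then have "\<sigma> * (\<sigma> * fst p) > 0"
      using assms(2) by (metis mult.assoc mult_pos_pos not_real_square_gt_zero)
    with elim assms(2) show ?case by auto
  qed
  with lim show ?thesis
    by (simp add: filterlim_at)
qed

text \<open>
  On the shifted curve the chain rule gives a derivative that is close to \<open>A * \<xi>' s + B\<close> for all
  small \<open>\<epsilon>\<close> and all \<open>t\<close> near \<open>s\<close>. The mean value inequality turns this into an estimate for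
  increments of \<open>f\<close> along the shifted curve, with no derivative in it, and that estimate passes
  to the limit \<open>\<epsilon> \<rightarrow> 0\<close> by continuity of \<open>f\<close>.
\<close>

lemma DERIV_along_graph_one_sided:
  fixes f :: "real \<times> real \<Rightarrow> real" and \<sigma> A B :: real
  assumes "open I" "s \<in> I" "\<sigma> \<noteq> 0"
    and \<xi>: "\<And>t. t \<in> I \<Longrightarrow> (\<xi> has_real_derivative \<xi>' t) (at t)"
    and cont_\<xi>': "isCont \<xi>' s"
    and f: "\<And>t. t \<in> I \<Longrightarrow> isCont f (\<xi> t, t)"
    and G: "open G" "C1_plane G f"
    and side: "\<forall>\<^sub>F (x, t) in nhds (\<xi> s, s). \<sigma> * (x - \<xi> t) > 0 \<longrightarrow> (x, t) \<in> G"
    and A: "(partial_x f \<longlongrightarrow> A) (at (\<xi> s, s) within G)"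
    and B: "(partial_t f \<longlongrightarrow> B) (at (\<xi> s, s) within G)"
  shows "((\<lambda>t. f (\<xi> t, t)) has_real_derivative A * \<xi>' s + B) (at s)"
proof -
  define L where "L = A * \<xi>' s + B"
  define q where "q = (\<lambda>\<epsilon> t. (\<xi> t + \<sigma> * \<epsilon>, t))"
  define F' where "F' = (\<lambda>\<epsilon> t. partial_x f (q \<epsilon> t) * \<xi>' t + partial_t f (q \<epsilon> t))"
  let ?R = "at_right (0::real) \<times>\<^sub>F nhds s"
  have q: "filterlim (\<lambda>p. q (fst p) (snd p)) (at (\<xi> s, s) within G) ?R"
    using filterlim_beside_graph[OF DERIV_isCont[OF \<xi>[OF assms(2)]] assms(3) side]
    by (simp add: q_def)
  then have inG: "\<forall>\<^sub>F p in ?R. q (fst p) (snd p) \<in> G"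
    unfolding filterlim_at by (auto elim: eventually_mono)
  have \<xi>': "((\<lambda>p. \<xi>' (snd p)) \<longlongrightarrow> \<xi>' s) ?R"
    using cont_\<xi>' by (intro filterlim_compose[OF _ filterlim_snd]) (simp add: isCont_def tendsto_nhds_iff)
  have "((\<lambda>p. F' (fst p) (snd p)) \<longlongrightarrow> L) ?R"
    unfolding F'_def L_def
    by (intro tendsto_intros filterlim_compose[OF A q] filterlim_compose[OF B q] \<xi>')
  have bound: "\<forall>\<^sub>F t in nhds s. \<bar>f (\<xi> t, t) - f (\<xi> s, s) - L * (t - s)\<bar> \<le> \<eta> * \<bar>t - s\<bar>"
    if "\<eta> > 0" for \<eta>
  proof -
    have "\<forall>\<^sub>F p in ?R. snd p \<in> I \<and> q (fst p) (snd p) \<in> G \<and> dist (F' (fst p) (snd p)) L < \<eta>"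
      using assms(1,2) that \<open>(_ \<longlongrightarrow> L) ?R\<close> 
      by (intro eventually_conj inG tendstoD 
        eventually_compose_filterlim[OF eventually_nhds_in_open filterlim_snd])
    then obtain E T where E: "\<forall>\<^sub>F \<epsilon> in at_right 0. E \<epsilon>" and T: "\<forall>\<^sub>F t in nhds s. T t"
      and near: "\<And>\<epsilon> t. E \<epsilon> \<Longrightarrow> T t \<Longrightarrow> t \<in> I \<and> q \<epsilon> t \<in> G \<and> dist (F' \<epsilon> t) L < \<eta>"
      unfolding eventually_prod_filter by auto
    from T obtain d where d: "d > 0" "\<And>t. dist t s < d \<Longrightarrow> T t"
      unfolding eventually_nhds_metric by blast
    have shifted: "\<bar>f (q \<epsilon> t) - f (q \<epsilon> s) - L * (t - s)\<bar> \<le> \<eta> * \<bar>t - s\<bar>"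
      if "E \<epsilon>" "dist t s < d" for \<epsilon> t
    proof -
      have deriv: "((\<lambda>t. f (q \<epsilon> t) - L * t) has_real_derivative F' \<epsilon> r - L) (at r within ball s d)"
        if "r \<in> ball s d" for r
      proof -
        have r: "r \<in> I" "q \<epsilon> r \<in> G"
          using near \<open>E \<epsilon>\<close> d(2) that by (auto simp: dist_commute)
        have "(q \<epsilon> has_derivative (\<lambda>k. (\<xi>' r * k, k))) (at r)"
          unfolding q_def using \<xi>[OF r(1)] unfolding has_field_derivative_def
          by (auto intro!: derivative_eq_intros)
        moreover have "(f has_derivative
            (\<lambda>(h, k). partial_x f (q \<epsilon> r) * h + partial_t f (q \<epsilon> r) * k)) (at (q \<epsilon> r))"
          using C1_plane_has_derivative[OF G] r(2) by (simp add: q_def)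
        ultimately have "((\<lambda>t. f (q \<epsilon> t)) has_derivative
            (\<lambda>k. case (\<xi>' r * k, k) of (h, k) \<Rightarrow>
              partial_x f (q \<epsilon> r) * h + partial_t f (q \<epsilon> r) * k)) (at r)"
          by (rule has_derivative_compose)
        then have "((\<lambda>t. f (q \<epsilon> t)) has_derivative (*) (F' \<epsilon> r)) (at r)"
          by (rule has_derivative_eq_rhs) (simp add: F'_def fun_eq_iff distrib_right mult.assoc)
        then show ?thesis
          unfolding has_field_derivative_def[symmetric]
          by (rule has_field_derivative_at_within[OF DERIV_diff[OF _ DERIV_cmult_Id]])
      qed
      have bounded: "norm (F' \<epsilon> r - L) \<le> \<eta>" if "r \<in> ball s d" for r
        using near[OF \<open>E \<epsilon>\<close> d(2), of r] that
        by (simp add: dist_commute dist_real_def abs_minus_commute less_imp_le)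
      have "norm ((f (q \<epsilon> t) - L * t) - (f (q \<epsilon> s) - L * s)) \<le> \<eta> * norm (t - s)"
        by (rule field_differentiable_bound[OF convex_ball deriv bounded])
          (use d(1) that(2) in \<open>simp_all add: dist_commute\<close>)
      then show ?thesis
        by (simp add: algebra_simps)
    qed
    have "\<bar>f (\<xi> t, t) - f (\<xi> s, s) - L * (t - s)\<bar> \<le> \<eta> * \<bar>t - s\<bar>" if "dist t s < d" for t
    proof -
      have lim: "((\<lambda>\<epsilon>. f (q \<epsilon> r)) \<longlongrightarrow> f (\<xi> r, r)) (at_right 0)" if "r \<in> I" for r
      proof (rule isCont_tendsto_compose[OF f[OF that]])
        have "((\<lambda>\<epsilon>. (\<xi> r + \<sigma> * \<epsilon>, r)) \<longlongrightarrow> (\<xi> r + \<sigma> * 0, r)) (at_right 0)"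
          by (intro tendsto_intros)
        then show "((\<lambda>\<epsilon>. q \<epsilon> r) \<longlongrightarrow> (\<xi> r, r)) (at_right 0)"
          by (simp add: q_def)
      qed
      obtain \<epsilon> where "E \<epsilon>"
        using eventually_happens'[OF _ E] by auto
      then have "t \<in> I"
        using near d(2) that by blast
      show ?thesis
      proof (rule tendsto_upperbound)
        show "((\<lambda>\<epsilon>. \<bar>f (q \<epsilon> t) - f (q \<epsilon> s) - L * (t - s)\<bar>)
            \<longlongrightarrow> \<bar>f (\<xi> t, t) - f (\<xi> s, s) - L * (t - s)\<bar>) (at_right 0)"
          by (intro tendsto_intros lim assms(2) \<open>t \<in> I\<close>)
        show "\<forall>\<^sub>F \<epsilon> in at_right 0. \<bar>f (q \<epsilon> t) - f (q \<epsilon> s) - L * (t - s)\<bar> \<le> \<eta> * \<bar>t - s\<bar>"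
          using E by eventually_elim (use shifted that in blast)
      qed auto
    qed
    then show ?thesis
      using d(1) by (auto simp: eventually_nhds_metric)
  qed
  have "((\<lambda>t. (f (\<xi> t, t) - f (\<xi> s, s)) / (t - s)) \<longlongrightarrow> L) (at s)"
  proof (rule tendstoI)
    fix e :: real assume "e > 0"
    then have "\<forall>\<^sub>F t in at s. \<bar>f (\<xi> t, t) - f (\<xi> s, s) - L * (t - s)\<bar> \<le> e / 2 * \<bar>t - s\<bar>"
      by (intro filter_leD[OF at_within_le_nhds bound]) simp
    moreover have "\<forall>\<^sub>F t in at s. t \<noteq> s"
      by (simp add: eventually_at_filter)
    ultimately show "\<forall>\<^sub>F t in at s. dist ((f (\<xi> t, t) - f (\<xi> s, s)) / (t - s)) L < e"
    proof eventually_elim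
      case (elim t)
      have "(f (\<xi> t, t) - f (\<xi> s, s)) / (t - s) - L
          = (f (\<xi> t, t) - f (\<xi> s, s) - L * (t - s)) / (t - s)"
        using elim(2) by (simp add: diff_divide_distrib)
      also have "\<bar>\<dots>\<bar> \<le> e / 2"
        unfolding abs_divide using elim by (subst pos_divide_le_eq) simp_all
      finally show ?case
        using \<open>e > 0\<close> by (simp add: dist_real_def)
    qed
  qed
  then show ?thesis
    unfolding has_field_derivative_iff L_def .
qed

section \<open>Jumps of derivatives across a curve\<close>

text \<open>
  Hadamard's compatibility condition: the derivative of \<open>f\<close> along the curve is the same number,
  whichever side it is computed from.
\<close>

lemma jump_condition_along_graph:
  fixes f :: "real \<times> real \<Rightarrow> real"
  assumes "divides_into D I \<xi> D1 D2" "open I" "s \<in> I"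
    and \<xi>: "\<And>t. t \<in> I \<Longrightarrow> (\<xi> has_real_derivative \<xi>' t) (at t)" "isCont \<xi>' s"
    and f: "\<And>t. t \<in> I \<Longrightarrow> isCont f (\<xi> t, t)" "C1_plane (D - graph_curve I \<xi>) f"
    and left: "(partial_x f \<longlongrightarrow> A1) (at (\<xi> s, s) within D1)"
      "(partial_t f \<longlongrightarrow> B1) (at (\<xi> s, s) within D1)"
    and right: "(partial_x f \<longlongrightarrow> A2) (at (\<xi> s, s) within D2)"
      "(partial_t f \<longlongrightarrow> B2) (at (\<xi> s, s) within D2)"
  shows "(A1 - A2) * \<xi>' s + (B1 - B2) = 0"
proof -
  have D12: "open D1" "open D2" "C1_plane D1 f" "C1_plane D2 f"
    and ev: "\<forall>\<^sub>F (x, t) in nhds (\<xi> s, s).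
        (x < \<xi> t \<longrightarrow> (x, t) \<in> D1) \<and> (x > \<xi> t \<longrightarrow> (x, t) \<in> D2)"
    using assms(1,3) C1_plane_subset[OF f(2)] by (auto simp: divides_into_def)
  have "((\<lambda>t. f (\<xi> t, t)) has_real_derivative A1 * \<xi>' s + B1) (at s)"
  proof (rule DERIV_along_graph_one_sided[OF assms(2,3) _ \<xi> f(1) D12(1,3) _ left])
    show "\<forall>\<^sub>F (x, t) in nhds (\<xi> s, s). (- 1) * (x - \<xi> t) > 0 \<longrightarrow> (x, t) \<in> D1"
      using ev by (rule eventually_mono) auto
  qed (simp)
  moreover have "((\<lambda>t. f (\<xi> t, t)) has_real_derivative A2 * \<xi>' s + B2) (at s)"
  proof (rule DERIV_along_graph_one_sided[OF assms(2,3) _ \<xi> f(1) D12(2,4) _ right])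
    show "\<forall>\<^sub>F (x, t) in nhds (\<xi> s, s). (1::real) * (x - \<xi> t) > 0 \<longrightarrow> (x, t) \<in> D2"
      using ev by (rule eventually_mono) auto
  qed (simp)
  ultimately have "A1 * \<xi>' s + B1 = A2 * \<xi>' s + B2"
    by (rule DERIV_unique)
  then show ?thesis
    by (simp add: algebra_simps)
qed

text \<open>
  Uniqueness of one-sided limits at the curve, by which the equation holds between the limits of
  the second derivatives, depends on this.
\<close>

lemma sides_accumulate_at_graph:
  assumes "divides_into D I \<xi> D1 D2" "s \<in> I" "isCont \<xi> s"
  shows "at (\<xi> s, s) within D1 \<noteq> bot" "at (\<xi> s, s) within D2 \<noteq> bot"
proof -
  have ev: "\<forall>\<^sub>F (x, t) in nhds (\<xi> s, s).
        (x < \<xi> t \<longrightarrow> (x, t) \<in> D1) \<and> (x > \<xi> t \<longrightarrow> (x, t) \<in> D2)"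
    using assms by (auto simp: divides_into_def)
  have "at_right (0::real) \<times>\<^sub>F nhds s \<noteq> bot"
    by (simp add: prod_filter_eq_bot)
  moreover have "filterlim (\<lambda>p. (\<xi> (snd p) + (- 1) * fst p, snd p)) (at (\<xi> s, s) within D1) (at_right 0 \<times>\<^sub>F nhds s)"
    using ev by (intro filterlim_beside_graph assms(3)) (auto intro: eventually_mono[OF ev])
  moreover have "filterlim (\<lambda>p. (\<xi> (snd p) + 1 * fst p, snd p)) (at (\<xi> s, s) within D2) (at_right 0 \<times>\<^sub>F nhds s)"
    using ev by (intro filterlim_beside_graph assms(3)) (auto intro: eventually_mono[OF ev])
  ultimately show "at (\<xi> s, s) within D1 \<noteq> bot" "at (\<xi> s, s) within D2 \<noteq> bot"
    by (auto simp: filterlim_def bot_unique filtermap_bot_iff)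
qed

text \<open>
  The two compatibility conditions, for the two first derivatives of \<open>u\<close>, together with the
  wave equation form a homogeneous linear system for the three jumps. It has a nonzero solution
  only if the slope is characteristic.
\<close>

lemma slope_of_weakly_discontinuous_curve:
  assumes "open D" "open I" "graph_curve I \<xi> \<subseteq> D" "s \<in> I"
    and \<xi>: "\<And>t. t \<in> I \<Longrightarrow> (\<xi> has_real_derivative \<xi>' t) (at t)" "isCont \<xi>' s"
    and weak: "weakly_discontinuous_curve \<nu> \<phi> \<psi> D I \<xi> u"
  shows "(\<xi>' s)\<^sup>2 = \<nu>\<^sup>2"
proof -
  obtain D1 D2 where div: "divides_into D I \<xi> D1 D2"
    and u: "C1_plane D u" "C2_plane (D - graph_curve I \<xi>) u"
    and wave: "wave_solution_off_curve \<nu> \<phi> \<psi> D (graph_curve I \<xi>) u"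
    and "\<And>p. p \<in> graph_curve I \<xi> \<Longrightarrow> first_kind_discontinuity (second_partials u) D1 D2 p"
    using weak unfolding weakly_discontinuous_curve_def by blast
  then have "first_kind_discontinuity (second_partials u) D1 D2 (\<xi> s, s)"
    using assms(4) by (auto simp: graph_curve_def)
  then obtain A1 B1 C1 A2 B2 C2 where
    lims: "(second_partials u \<longlongrightarrow> (A1, B1, C1)) (at (\<xi> s, s) within D1)"
      "(second_partials u \<longlongrightarrow> (A2, B2, C2)) (at (\<xi> s, s) within D2)"
    and jump: "(A1, B1, C1) \<noteq> (A2, B2, C2)"
    unfolding first_kind_discontinuity_def by (metis prod_cases3)
  have D12: "open D1" "open D2" "D - graph_curve I \<xi> = D1 \<union> D2"
    using div by (auto simp: divides_into_def)
  have xx: "(partial_x (partial_x u) \<longlongrightarrow> A1) (at (\<xi> s, s) within D1)"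
      "(partial_x (partial_x u) \<longlongrightarrow> A2) (at (\<xi> s, s) within D2)"
    and xt: "(partial_t (partial_x u) \<longlongrightarrow> B1) (at (\<xi> s, s) within D1)"
      "(partial_t (partial_x u) \<longlongrightarrow> B2) (at (\<xi> s, s) within D2)"
    and tt: "(partial_t (partial_t u) \<longlongrightarrow> C1) (at (\<xi> s, s) within D1)"
      "(partial_t (partial_t u) \<longlongrightarrow> C2) (at (\<xi> s, s) within D2)"
    using lims[THEN tendsto_fst] lims[THEN tendsto_snd, THEN tendsto_fst]
      lims[THEN tendsto_snd, THEN tendsto_snd] by (simp_all add: second_partials_def)
  have transfer: "(g \<longlongrightarrow> l) (at p within S)"
    if "(f \<longlongrightarrow> l) (at p within S)" "\<And>q. q \<in> S \<Longrightarrow> f q = g q"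
    for f g :: "real \<times> real \<Rightarrow> real" and l p S
    by (rule Lim_transform_eventually[OF that(1)]) (simp add: eventually_at_filter that(2))
  have mixed: "partial_t (partial_x u) p = partial_x (partial_t u) p" if "p \<in> D1 \<union> D2" for p
    using C2_plane_mixed_partials_eq[of "D1 \<union> D2" u "fst p" "snd p"] that D12 u(2) by auto
  have tx: "(partial_x (partial_t u) \<longlongrightarrow> B1) (at (\<xi> s, s) within D1)"
      "(partial_x (partial_t u) \<longlongrightarrow> B2) (at (\<xi> s, s) within D2)"
    using xt mixed by (auto intro: transfer)
  have eq: "partial_t (partial_t u) p = \<nu>\<^sup>2 * partial_x (partial_x u) p" if "p \<in> D1 \<union> D2" for p
    using wave that D12(3) by (auto simp: wave_solution_off_curve_def)
  have "(partial_t (partial_t u) \<longlongrightarrow> \<nu>\<^sup>2 * A1) (at (\<xi> s, s) within D1)"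
      "(partial_t (partial_t u) \<longlongrightarrow> \<nu>\<^sup>2 * A2) (at (\<xi> s, s) within D2)"
    using xx[THEN tendsto_mult_left[of _ _ _ "\<nu>\<^sup>2"]] eq by (auto intro: transfer)
  then have C: "C1 = \<nu>\<^sup>2 * A1" "C2 = \<nu>\<^sup>2 * A2"
    using tt sides_accumulate_at_graph[OF div assms(4) DERIV_isCont[OF \<xi>(1)[OF assms(4)]]]
    by (auto intro: tendsto_unique)
  have cont: "isCont (partial_x u) (\<xi> t, t)" "isCont (partial_t u) (\<xi> t, t)" if "t \<in> I" for t
    using u(1) that assms(1,3) continuous_on_eq_continuous_at
    by (auto simp: C1_plane_def graph_curve_def)
  have "(A1 - A2) * \<xi>' s + (B1 - B2) = 0"
    using u(2) by (intro jump_condition_along_graph[OF div assms(2,4) \<xi> cont(1)] xx xt)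
      (auto simp: C2_plane_def)
  moreover have "(B1 - B2) * \<xi>' s + (C1 - C2) = 0"
    using u(2) by (intro jump_condition_along_graph[OF div assms(2,4) \<xi> cont(2)] tx tt)
      (auto simp: C2_plane_def)
  ultimately have char: "(A1 - A2) * ((\<xi>' s)\<^sup>2 - \<nu>\<^sup>2) = 0" and B: "B1 - B2 = - (A1 - A2) * \<xi>' s"
    unfolding C by algebra+
  \<comment> \<open>If \<open>u\<^sub>x\<^sub>x\<close> did not jump, then neither would the other two second derivatives.\<close>
  have "A1 \<noteq> A2"
    using jump B by (auto simp: C)
  with char show ?thesis
    by simp
qed

section \<open>Weakly discontinuous curves are characteristics\<close>

theorem theorem2:
  fixes a c \<nu> :: real
    and \<phi> \<psi> :: "real \<Rightarrow> real"
    and D :: "(real \<times> real) set"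
    and I :: "real set"
    and \<xi> :: "real \<Rightarrow> real"
    and u :: "real \<times> real \<Rightarrow> real"
  assumes "c > 0" and "- a * c > 0"
    and "\<nu>\<^sup>2 = - a / c" and "\<nu> > 0"
    and "\<phi> differentiable_on UNIV" and "deriv \<phi> C1_differentiable_on UNIV"
    and "\<psi> C1_differentiable_on UNIV"
    and "domain_in_plane D"
    and "open I" and "is_interval I" and "I \<noteq> {}"
    and "\<xi> C1_differentiable_on I"
    and "graph_curve I \<xi> \<subseteq> D"
    and "weakly_discontinuous_curve \<nu> \<phi> \<psi> D I \<xi> u"
  shows "{r :: real. c * r\<^sup>2 + a = 0} = {\<nu>, - \<nu>} \<and>
    ((\<forall>t\<in>I. (\<xi> has_real_derivative \<nu>) (at t)) \<or>
     (\<forall>t\<in>I. (\<xi> has_real_derivative - \<nu>) (at t)))"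
proof
  have "c * r\<^sup>2 + a = c * (r\<^sup>2 - \<nu>\<^sup>2)" for r
    using assms(1,3) by (simp add: field_simps)
  then show "{r :: real. c * r\<^sup>2 + a = 0} = {\<nu>, - \<nu>}"
    using assms(1) by (auto simp: power2_eq_iff)
next
  obtain \<xi>' where \<xi>': "\<And>t. t \<in> I \<Longrightarrow> (\<xi> has_real_derivative \<xi>' t) (at t)" "continuous_on I \<xi>'"
    using assms(12) unfolding C1_differentiable_on_def
    by (auto simp: has_real_derivative_iff_has_vector_derivative)
  have slope: "\<xi>' t = \<nu> \<or> \<xi>' t = - \<nu>" if "t \<in> I" for t
    using slope_of_weakly_discontinuous_curve[OF _ assms(9,13) that \<xi>'(1) _ assms(14)]
      assms(8) \<xi>'(2) that continuous_on_eq_continuous_at[OF assms(9)]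
    by (auto simp: domain_in_plane_def power2_eq_iff)
  have "\<xi>' constant_on I"
  proof (rule continuous_finite_range_constant)
    show "connected I"
      using assms(10) by (rule is_interval_connected)
    show "finite (\<xi>' ` I)"
      using slope by (auto intro: finite_subset[of _ "{\<nu>, - \<nu>}"])
  qed (rule \<xi>'(2))
  then obtain k where k: "\<And>t. t \<in> I \<Longrightarrow> \<xi>' t = k"
    by (auto simp: constant_on_def)
  then have "k = \<nu> \<or> k = - \<nu>"
    using slope assms(11) by blast
  then show "(\<forall>t\<in>I. (\<xi> has_real_derivative \<nu>) (at t)) \<or>
     (\<forall>t\<in>I. (\<xi> has_real_derivative - \<nu>) (at t))"
    using \<xi>'(1) k by auto
qed

end
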